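(* Suppose that $1<p<\infty$ and $0<\beta\le\frac1p$. Then there exists a positive Borel measure $\mu$ on $[0,1)$ which is a $\beta$-logarithmic $1$-Carleson measure but such that the operator $\mathcal H_\mu$ does not map $B^p$ into itself, i.e. $\mathcal H_\mu(B^p)\not\subset B^p$.
   Context: $\mathbb D=\{z\in\mathbb C:|z|<1\}$, and $dA(z)=\frac{dx\,dy}{\pi}$. For $1<p<\infty$ the analytic Besov space $B^p$ is the set of analytic functions $f$ in $\mathbb D$ with $\|f\|_{B^p}=\left(|f(0)|^p+\rho_p(f)^p\right)^{1/p}<\infty$, where $\rho_p(f)=\left(\int_{\mathbb D}(1-|z|^2)^{p-2}|f'(z)|^p\,dA(z)\right)^{1/p}$. For $\alpha\ge0$ and $s>0$, a positive Borel measure $\mu$ on $[0,1)$ is an $\alpha$-logarithmic $s$-Carleson measure if there is $C>0$ with $\mu([t,1))\left(\log\frac{2}{1-t}\right)^\alpha\le C(1-t)^s$ for all $0\le t<1$. For a finite positive Borel measure $\mu$ on $[0,1)$, $\mu_n=\int_{[0,1)}t^n\,d\mu(t)$, and for $f(z)=\sum_{k\ge0}a_kz^k$ analytic in $\mathbb D$, $$\mathcal H_\mu(f)(z)=\sum_{n=0}^\infty\Big(\sum_{k=0}^\infty\mu_{n+k}a_k\Big)z^n,$$ whenever the right-hand side makes sense and defines an analytic function in $\mathbb D$. (For a $\beta$-logarithmic $1$-Carleson measure $\mu$, $\beta\ge0$, the operator $\mathcal H_\mu$ is well defined on $B^p$.) *)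

theory Defs
  imports "HOL-Complex_Analysis.Complex_Analysis"
begin

definition normalized_area :: "complex measure" where
  "normalized_area = density lborel (\<lambda>_. ennreal (1 / pi))"

(* Real powers on [0, \<infinity>], with \<infinity> ^ a = \<infinity>; only used for exponents a > 0. *)
definition ennpowr :: "ennreal \<Rightarrow> real \<Rightarrow> ennreal" where
  "ennpowr x a = (if x = \<infinity> then \<infinity> else ennreal (enn2real x powr a))"

definition besov_seminorm :: "real \<Rightarrow> (complex \<Rightarrow> complex) \<Rightarrow> ennreal" where
  "besov_seminorm p f =
     ennpowr (\<integral>\<^sup>+z\<in>ball 0 1. ennreal ((1 - (norm z)\<^sup>2) powr (p - 2) * norm (deriv f z) powr p)
                \<partial>normalized_area) (1 / p)"

definition besov_norm :: "real \<Rightarrow> (complex \<Rightarrow> complex) \<Rightarrow> ennreal" where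
  "besov_norm p f = ennpowr (ennreal (norm (f 0) powr p) + ennpowr (besov_seminorm p f) p) (1 / p)"

(* Functions on the disc are represented by total functions whose values outside the disc
   are irrelevant. *)
definition besov_space :: "real \<Rightarrow> (complex \<Rightarrow> complex) set" where
  "besov_space p = {f. f holomorphic_on ball 0 1 \<and> besov_norm p f < \<infinity>}"

definition borel_measure_unit :: "real measure \<Rightarrow> bool" where
  "borel_measure_unit \<mu> \<longleftrightarrow> sets \<mu> = sets (restrict_space borel {0..<1})"

definition log_carleson :: "real \<Rightarrow> real \<Rightarrow> real measure \<Rightarrow> bool" where
  "log_carleson \<alpha> s \<mu> \<longleftrightarrow> borel_measure_unit \<mu> \<and>
     (\<exists>C>0. \<forall>t\<in>{0..<1}.
        emeasure \<mu> {t..<1} * ennreal (ln (2 / (1 - t)) powr \<alpha>) \<le> ennreal (C * (1 - t) powr s))"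

(* The moments below are Bochner integrals; the Carleson condition at t = 0 makes the measure
   finite, so that they are the usual ones. *)
lemma log_carleson_finite_measure:
  assumes "log_carleson \<alpha> s \<mu>"
  shows "finite_measure \<mu>"
proof
  from assms obtain C where
    "emeasure \<mu> {0..<1} * ennreal (ln (2 / (1 - 0)) powr \<alpha>) \<le> ennreal (C * (1 - 0) powr s)"
    unfolding log_carleson_def by fastforce
  then have "emeasure \<mu> {0..<1} * ennreal (ln 2 powr \<alpha>) < top"
    by (simp add: le_less_trans)
  moreover have "ennreal (ln 2 powr \<alpha>) \<noteq> 0"
    by simp
  ultimately have "emeasure \<mu> {0..<1} \<noteq> top"
    by (auto simp: ennreal_top_mult)
  moreover have "space \<mu> = {0..<1}"
    using assms sets_eq_imp_space_eq[of \<mu> "restrict_space borel {0..<1}"]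
    by (simp add: log_carleson_def borel_measure_unit_def space_restrict_space)
  ultimately show "emeasure \<mu> (space \<mu>) \<noteq> \<infinity>"
    by simp
qed

definition moment :: "real measure \<Rightarrow> nat \<Rightarrow> real" where
  "moment \<mu> n = (\<integral>t. t ^ n \<partial>\<mu>)"

definition taylor_coeff :: "(complex \<Rightarrow> complex) \<Rightarrow> nat \<Rightarrow> complex" where
  "taylor_coeff f k = (deriv ^^ k) f 0 / fact k"

definition hankel_coeff :: "real measure \<Rightarrow> (complex \<Rightarrow> complex) \<Rightarrow> nat \<Rightarrow> complex" where
  "hankel_coeff \<mu> f n = (\<Sum>k. of_real (moment \<mu> (n + k)) * taylor_coeff f k)"

definition hankel_op :: "real measure \<Rightarrow> (complex \<Rightarrow> complex) \<Rightarrow> complex \<Rightarrow> complex" where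
  "hankel_op \<mu> f z = (\<Sum>n. hankel_coeff \<mu> f n * z ^ n)"

(* suminf is total, so the functions at which the operator makes sense are recorded separately:
   all the series converge and the sum is analytic in the disc. *)
definition hankel_domain :: "real measure \<Rightarrow> (complex \<Rightarrow> complex) set" where
  "hankel_domain \<mu> = {f. f holomorphic_on ball 0 1 \<and>
     (\<forall>n. summable (\<lambda>k. of_real (moment \<mu> (n + k)) * taylor_coeff f k)) \<and>
     (\<forall>z\<in>ball 0 1. summable (\<lambda>n. hankel_coeff \<mu> f n * z ^ n)) \<and>
     hankel_op \<mu> f holomorphic_on ball 0 1}"

end

theory Submission
  imports Defs
begin

text \<open>
  The constant function \<open>1\<close> already leaves the Besov space. Take
  \<open>d\<mu>(t) = (log (2 / (1 - t)))\<^sup>-\<^sup>\<beta> dt\<close>. Its density decreases, so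
  \<open>\<mu>([t,1))\<close> is at most \<open>1 - t\<close> times the density at \<open>t\<close>, which is the
  \<open>\<beta>\<close>-logarithmic 1-Carleson condition with constant \<open>1\<close>
  (\<open>log_carleson_log_measure\<close>).

  The image of \<open>1\<close> is \<open>F(z) = \<Sum> \<mu>\<^sub>n z\<^sup>n = \<integral> 1 / (1 - tz) d\<mu>(t)\<close>, and
  \<open>F'(z) = \<integral> t / (1 - tz)\<^sup>2 d\<mu>(t)\<close> (\<open>deriv_hankel_op_one\<close>). Put \<open>r = 2\<^sup>-\<^sup>k\<close>, \<open>k \<ge> 1\<close>. On
  the disk of centre \<open>1 - r\<close> and radius \<open>r / 4\<close> the number \<open>1 - tz\<close> stays in a fixed narrow
  sector around the positive axis, so that no cancellation occurs in this integral: its real part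
  is at least a constant times \<open>r\<^sup>-\<^sup>2 \<mu>([1 - r, 1 - r/2])\<close>
  (\<open>norm_deriv_hankel_op_one_ge\<close>). For the chosen measure this is comparable with
  \<open>r\<^sup>-\<^sup>1 k\<^sup>-\<^sup>\<beta>\<close>.

  The disks are disjoint, the weight \<open>(1 - \<bar>z\<bar>\<^sup>2)\<^sup>p\<^sup>-\<^sup>2\<close> is comparable with \<open>r\<^sup>p\<^sup>-\<^sup>2\<close> on each
  of them and their areas are comparable with \<open>r\<^sup>2\<close>. All powers of \<open>r\<close> cancel, and the Besov
  integral of \<open>F\<close> is at least a constant times \<open>\<Sum> k\<^sup>-\<^sup>\<beta>\<^sup>p\<close>
  (\<open>not_in_besov_space_if_derivative_large\<close>). This series diverges exactly when
  \<open>\<beta> \<le> 1 / p\<close>.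
\<close>

section \<open>Measures on the unit interval and their moments\<close>

lemma space_borel_measure_unit:
  "borel_measure_unit \<mu> \<Longrightarrow> space \<mu> = {0..<1}"
  using sets_eq_imp_space_eq[of \<mu> "restrict_space borel {0..<1}"]
  by (simp add: borel_measure_unit_def space_restrict_space)

lemma borel_measurable_unit:
  assumes "borel_measure_unit \<mu>" "f \<in> borel_measurable borel"
  shows "f \<in> borel_measurable \<mu>"
  using assms measurable_restrict_space1[OF assms(2), of "{0..<1}"]
  by (simp add: borel_measure_unit_def cong: measurable_cong_sets)

lemma sets_unit:
  assumes "borel_measure_unit \<mu>" "A \<in> sets borel" "A \<subseteq> {0..<1}"
  shows "A \<in> sets \<mu>"
  using assms by (auto simp: borel_measure_unit_def sets_restrict_space_iff)

lemma integrable_unit_bounded: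
  fixes f :: "real \<Rightarrow> 'b::{banach, second_countable_topology}"
  assumes "finite_measure \<mu>" "borel_measure_unit \<mu>" "f \<in> borel_measurable borel"
    and "\<And>t. 0 \<le> t \<Longrightarrow> t < 1 \<Longrightarrow> norm (f t) \<le> B"
  shows "integrable \<mu> f"
  by (rule finite_measure.integrable_const_bound[where B = B])
     (use assms borel_measurable_unit space_borel_measure_unit in \<open>auto intro!: AE_I2\<close>)

lemma moment_bounds:
  assumes "finite_measure \<mu>" "borel_measure_unit \<mu>"
  shows "0 \<le> moment \<mu> n" "moment \<mu> n \<le> measure \<mu> (space \<mu>)"
proof -
  show "0 \<le> moment \<mu> n"
    unfolding moment_def using space_borel_measure_unit[OF assms(2)]
    by (intro Bochner_Integration.integral_nonneg) auto
  have "moment \<mu> n \<le> (\<integral>t. 1 \<partial>\<mu>)"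
    unfolding moment_def using space_borel_measure_unit[OF assms(2)]
    by (intro integral_mono integrable_unit_bounded[where B = 1] assms)
       (auto simp: power_le_one)
  then show "moment \<mu> n \<le> measure \<mu> (space \<mu>)" by simp
qed

section \<open>The image of the constant function\<close>

lemma taylor_coeff_one: "taylor_coeff (\<lambda>_. 1) k = (if k = 0 then 1 else 0)"
  by (cases k) (auto simp: taylor_coeff_def funpow_swap1 simp del: funpow.simps)

lemma hankel_term_one:
  "(\<lambda>k. of_real (moment \<mu> (n + k)) * taylor_coeff (\<lambda>_. 1) k)
     sums of_real (moment \<mu> n)"
  using sums_If_finite_set[of "{0}" "\<lambda>k. complex_of_real (moment \<mu> (n + k))"]
  by (simp add: taylor_coeff_one if_distrib cong: if_cong)

lemma hankel_coeff_one: "hankel_coeff \<mu> (\<lambda>_. 1) n = of_real (moment \<mu> n)"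
  unfolding hankel_coeff_def using hankel_term_one by (rule sums_unique[symmetric])

lemma summable_moment_series:
  assumes "finite_measure \<mu>" "borel_measure_unit \<mu>" "norm z < 1"
  shows "summable (\<lambda>n. complex_of_real (moment \<mu> n) * z ^ n)"
proof (rule summable_comparison_test'[where N = 0])
  show "summable (\<lambda>n. measure \<mu> (space \<mu>) * norm z ^ n)"
    using assms by (intro summable_mult summable_geometric) auto
  show "norm (complex_of_real (moment \<mu> n) * z ^ n) \<le> measure \<mu> (space \<mu>) * norm z ^ n" for n
    using moment_bounds[OF assms(1,2), of n]
    by (auto simp: norm_mult norm_power intro!: mult_right_mono)
qed

lemma hankel_op_one: "hankel_op \<mu> (\<lambda>_. 1) = (\<lambda>z. \<Sum>n. of_real (moment \<mu> n) * z ^ n)"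
  by (auto simp: hankel_op_def hankel_coeff_one)

lemma hankel_op_one_has_derivative:
  assumes "finite_measure \<mu>" "borel_measure_unit \<mu>" "norm z < 1"
  shows "(hankel_op \<mu> (\<lambda>_. 1) has_field_derivative
           (\<Sum>n. diffs (\<lambda>n. complex_of_real (moment \<mu> n)) n * z ^ n)) (at z)"
  unfolding hankel_op_one
  using summable_moment_series[OF assms(1,2)] assms(3) by (rule termdiffs_strong')

lemma one_in_hankel_domain:
  assumes "finite_measure \<mu>" "borel_measure_unit \<mu>"
  shows "(\<lambda>_. 1) \<in> hankel_domain \<mu>"
  unfolding hankel_domain_def
proof (intro CollectI conjI allI ballI)
  show "hankel_op \<mu> (\<lambda>_. 1) holomorphic_on ball 0 1"
    unfolding holomorphic_on_open[OF open_ball]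
    by (intro ballI exI, rule hankel_op_one_has_derivative[OF assms]) simp
qed (use hankel_term_one summable_moment_series[OF assms] in
      \<open>auto simp: hankel_coeff_one sums_iff\<close>)

lemma one_in_besov_space: "(\<lambda>_. 1) \<in> besov_space p"
  by (simp add: besov_space_def besov_norm_def besov_seminorm_def ennpowr_def ennreal_plus[symmetric]
           del: ennreal_plus)

section \<open>The derivative of the image as an integral\<close>

lemma norm_one_minus_mult_ge:
  fixes z :: complex and t :: real
  assumes "0 \<le> t" "t < 1"
  shows "1 - norm z \<le> norm (1 - of_real t * z)"
proof -
  have "norm (of_real t * z) \<le> norm z"
    using assms by (simp add: norm_mult mult_left_le_one_le)
  then show ?thesis
    using norm_triangle_ineq2[of 1 "of_real t * z"] by simp
qed

lemma integrable_cauchy_square_kernel: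
  fixes z :: complex
  assumes "finite_measure \<mu>" "borel_measure_unit \<mu>" "norm z < 1"
  shows "integrable \<mu> (\<lambda>t. of_real t / (1 - of_real t * z)\<^sup>2)"
proof (rule integrable_unit_bounded[OF assms(1,2), where B = "1 / (1 - norm z)\<^sup>2"])
  fix t :: real assume t: "0 \<le> t" "t < 1"
  have "t / (norm (1 - of_real t * z))\<^sup>2 \<le> 1 / (1 - norm z)\<^sup>2"
    using norm_one_minus_mult_ge[OF t, of z] t assms(3)
    by (intro frac_le power_mono) auto
  then show "norm (complex_of_real t / (1 - of_real t * z)\<^sup>2) \<le> 1 / (1 - norm z)\<^sup>2"
    using t by (simp add: norm_divide norm_power)
qed measurable

text \<open>
  Expanding \<open>t / (1 - tz)\<^sup>2 = \<Sum> (n + 1) t\<^sup>n\<^sup>+\<^sup>1 z\<^sup>n\<close> under the integral gives the termwise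
  derivative of the moment series. The terms are dominated by \<open>(n + 1) \<bar>z\<bar>\<^sup>n\<close>, which is summable
  and independent of \<open>t\<close>, so on a finite measure sum and integral may be exchanged.
\<close>
lemma deriv_hankel_op_one:
  assumes fin: "finite_measure \<mu>" and unit: "borel_measure_unit \<mu>" and z: "norm z < 1"
  shows "deriv (hankel_op \<mu> (\<lambda>_. 1)) z = (\<integral>t. of_real t / (1 - of_real t * z)\<^sup>2 \<partial>\<mu>)"
proof -
  let ?g = "\<lambda>n t. of_nat (Suc n) * (of_real t) ^ Suc n * z ^ n :: complex"
  have sg: "summable (\<lambda>n. real (Suc n) * norm z ^ n)"
    using geometric_deriv_sums[of "norm z"] z by (auto simp: sums_iff)
  have bound: "norm (?g n t) \<le> real (Suc n) * norm z ^ n" if "0 \<le> t" "t < 1" for n t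
  proof -
    have "norm (?g n t) = real (Suc n) * norm z ^ n * t ^ Suc n"
      using that by (simp only: norm_mult norm_power norm_of_nat norm_of_real) simp
    also have "\<dots> \<le> real (Suc n) * norm z ^ n"
      using that by (intro mult_right_le_one_le power_le_one mult_nonneg_nonneg) auto
    finally show ?thesis .
  qed
  have int: "integrable \<mu> (?g n)" for n
    by (rule integrable_unit_bounded[OF fin unit _ bound])
       (auto intro!: borel_measurable_continuous_onI continuous_intros)
  have coeff: "diffs (\<lambda>n. complex_of_real (moment \<mu> n)) n * z ^ n = (\<integral>t. ?g n t \<partial>\<mu>)" for n
  proof -
    have "(\<integral>t. ?g n t \<partial>\<mu>) = of_nat (Suc n) * (\<integral>t. of_real (t ^ Suc n) \<partial>\<mu>) * z ^ n"
      by (simp only: of_real_power integral_mult_left_zero integral_mult_right_zero)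
    then show ?thesis
      by (simp only: integral_complex_of_real moment_def diffs_def)
  qed
  have kernel: "(\<Sum>n. ?g n t) = of_real t / (1 - of_real t * z)\<^sup>2" if "t \<in> space \<mu>" for t
  proof -
    have t: "0 \<le> t" "t < 1" using that space_borel_measure_unit[OF unit] by auto
    then have "norm (of_real t * z) < 1"
      using z mult_left_le_one_le[of "norm z" t] by (auto simp: norm_mult)
    from sums_mult[OF geometric_deriv_sums[OF \<open>norm (of_real t * z) < 1\<close>], of "of_real t"]
    have "(\<lambda>n. ?g n t) sums (of_real t * (1 / (1 - of_real t * z)\<^sup>2))"
      by (simp add: power_mult_distrib algebra_simps)
    then show ?thesis by (simp add: sums_iff)
  qed
  have "deriv (hankel_op \<mu> (\<lambda>_. 1)) z = (\<Sum>n. \<integral>t. ?g n t \<partial>\<mu>)"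
    using hankel_op_one_has_derivative[OF assms] by (simp add: DERIV_imp_deriv coeff)
  also have "\<dots> = (\<integral>t. (\<Sum>n. ?g n t) \<partial>\<mu>)"
  proof (rule integral_suminf[symmetric, OF int])
    show "AE t in \<mu>. summable (\<lambda>n. norm (?g n t))"
      using bound space_borel_measure_unit[OF unit]
      by (intro AE_I2 summable_comparison_test'[OF sg, where N = 0]) auto
    show "summable (\<lambda>n. \<integral>t. norm (?g n t) \<partial>\<mu>)"
    proof (rule summable_comparison_test'[where N = 0])
      show "summable (\<lambda>n. measure \<mu> (space \<mu>) * (real (Suc n) * norm z ^ n))"
        using sg by (rule summable_mult)
      fix n
      have "(\<integral>t. norm (?g n t) \<partial>\<mu>) \<le> (\<integral>t. real (Suc n) * norm z ^ n \<partial>\<mu>)"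
        using bound[of _ n] space_borel_measure_unit[OF unit]
        by (intro integral_mono integrable_norm int finite_measure.integrable_const fin) auto
      moreover have "0 \<le> (\<integral>t. norm (?g n t) \<partial>\<mu>)"
        by (rule Bochner_Integration.integral_nonneg) simp
      ultimately show "norm (\<integral>t. norm (?g n t) \<partial>\<mu>)
          \<le> measure \<mu> (space \<mu>) * (real (Suc n) * norm z ^ n)"
        by (simp del: of_nat_Suc)
    qed
  qed
  also have "\<dots> = (\<integral>t. of_real t / (1 - of_real t * z)\<^sup>2 \<partial>\<mu>)"
    using kernel by (rule Bochner_Integration.integral_cong[OF refl])
  finally show ?thesis .
qed

section \<open>Lower bound for the derivative near the point 1\<close>

text \<open>
  If \<open>u = a + ib\<close> lies within \<open>s / 4\<close> of \<open>s > 0\<close>, then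
  \<open>Re (1 / u\<^sup>2) = (a\<^sup>2 - b\<^sup>2) / \<bar>u\<bar>\<^sup>4\<close>, where the numerator is at least
  \<open>(9/16 - 1/16) s\<^sup>2\<close> and the denominator at most \<open>(5/4)\<^sup>4 s\<^sup>4 \<le> 5/2 s\<^sup>4\<close>.
\<close>
lemma Re_inverse_square_ge:
  fixes u :: complex and s :: real
  assumes "0 < s" and "norm (u - of_real s) \<le> s / 4"
  shows "1 / (5 * s\<^sup>2) \<le> Re (1 / u\<^sup>2)"
proof -
  define a b where "a = Re u" and "b = Im u"
  have "\<bar>a - s\<bar> \<le> s / 4" "\<bar>b\<bar> \<le> s / 4"
    using assms(2) abs_Re_le_cmod[of "u - of_real s"] abs_Im_le_cmod[of "u - of_real s"]
    by (auto simp: a_def b_def)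
  then have a: "3 / 4 * s \<le> a" and b: "\<bar>b\<bar> \<le> s / 4"
    by linarith+
  have "norm u \<le> norm (of_real s :: complex) + norm (u - of_real s)"
    by (metis diff_add_cancel norm_triangle_ineq add.commute)
  then have nu: "norm u \<le> 5 / 4 * s" using assms by simp
  have "3 / 4 * s \<le> norm u" using a abs_Re_le_cmod[of u] by (simp add: a_def)
  then have nu0: "0 < norm u" using assms(1) by linarith
  have "(3 / 4 * s)\<^sup>2 \<le> a\<^sup>2" using a assms(1) by (intro power_mono) auto
  moreover have "b\<^sup>2 \<le> (s / 4)\<^sup>2" using b assms(1) by (intro abs_le_square_iff[THEN iffD1]) auto
  ultimately have num: "s\<^sup>2 / 2 \<le> a\<^sup>2 - b\<^sup>2"
    by (simp add: power_mult_distrib power_divide)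
  have "(norm u) ^ 4 \<le> (5 / 4 * s) ^ 4" using nu by (intro power_mono) auto
  also have "\<dots> \<le> 5 / 2 * s ^ 4" by (simp add: power_mult_distrib power_divide)
  finally have den: "(norm u) ^ 4 \<le> 5 / 2 * s ^ 4" .
  have "1 / (5 * s\<^sup>2) = (s\<^sup>2 / 2) / (5 / 2 * s ^ 4)"
    using assms(1) by (simp add: field_simps power2_eq_square power4_eq_xxxx)
  also have "\<dots> \<le> (a\<^sup>2 - b\<^sup>2) / (norm u) ^ 4"
  proof (rule frac_le)
    show "0 \<le> a\<^sup>2 - b\<^sup>2" using num zero_le_power2[of s] by linarith
  qed (use num den nu0 in auto)
  also have "\<dots> = Re (1 / u\<^sup>2)"
  proof -
    have "(Re (u\<^sup>2))\<^sup>2 + (Im (u\<^sup>2))\<^sup>2 = (norm (u\<^sup>2))\<^sup>2" by (simp add: cmod_power2)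
    also have "\<dots> = norm u ^ 4" by (simp add: norm_power)
    finally show ?thesis by (simp add: Re_divide a_def b_def Re_power2)
  qed
  finally show ?thesis .
qed

text \<open>
  The real part is nonnegative for every \<open>t\<close>, so the integral over \<open>[0,1)\<close> is not smaller than
  the part over \<open>[1 - r, 1 - r/2]\<close>. There \<open>t \<ge> 1/2\<close> and \<open>s = 1 - t (1 - r) \<le> 2r\<close>, which turns
  \<open>t / (5 s\<^sup>2)\<close> into \<open>1 / (40 r\<^sup>2)\<close>.
\<close>
lemma Re_cauchy_square_kernel_ge:
  fixes z :: complex
  assumes r: "0 < r" "r \<le> 1 / 2" and z: "norm (z - of_real (1 - r)) \<le> r / 4"
    and t: "0 \<le> t" "t < 1"
  shows "indicator {1 - r..1 - r / 2} t / (40 * r\<^sup>2) \<le> Re (of_real t / (1 - of_real t * z)\<^sup>2)"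
proof -
  \<comment> \<open>\<open>s\<close> is the value of \<open>1 - tz\<close> at the centre of the disk. Since \<open>s \<ge> r\<close>, on the disk
     \<open>1 - tz\<close> stays within \<open>s / 4\<close> of \<open>s\<close>.\<close>
  define s where "s = 1 - t * (1 - r)"
  have "t * (1 - r) \<le> 1 - r" using t r by (intro mult_left_le_one_le) auto
  then have rs: "r \<le> s" by (simp add: s_def)
  have "(1 - of_real t * z) - of_real s = - (of_real t * (z - of_real (1 - r)))"
    by (simp add: s_def algebra_simps)
  then have "norm ((1 - of_real t * z) - of_real s) = t * norm (z - of_real (1 - r))"
    using t by (simp only: norm_minus_cancel norm_mult norm_of_real abs_of_nonneg)
  also have "\<dots> \<le> norm (z - of_real (1 - r))"
    using t by (intro mult_left_le_one_le) auto
  finally have "norm ((1 - of_real t * z) - of_real s) \<le> s / 4" using z rs by linarith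
  then have "1 / (5 * s\<^sup>2) \<le> Re (1 / (1 - of_real t * z)\<^sup>2)"
    using r rs by (intro Re_inverse_square_ge) auto
  from mult_left_mono[OF this t(1)]
  have ge: "t / (5 * s\<^sup>2) \<le> Re (of_real t / (1 - of_real t * z)\<^sup>2)"
    by (simp add: Re_divide)
  show ?thesis
  proof (cases "t \<in> {1 - r..1 - r / 2}")
    case True
    then have t': "1 - r \<le> t" by simp
    then have "(1 - r) * (1 - r) \<le> t * (1 - r)" using r by (intro mult_right_mono) auto
    then have "s \<le> 2 * r" using zero_le_square[of r] unfolding s_def left_diff_distrib right_diff_distrib by linarith
    then have "s\<^sup>2 \<le> (2 * r)\<^sup>2" using r rs by (intro power_mono) auto
    then have "(1 / 2) / (5 * (4 * r\<^sup>2)) \<le> t / (5 * s\<^sup>2)"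
      using r rs t' by (intro frac_le) (auto simp: power_mult_distrib)
    with ge True show ?thesis by simp
  next
    case False
    have "0 \<le> t / (5 * s\<^sup>2)" using t by simp
    with ge False show ?thesis by simp
  qed
qed

lemma norm_deriv_hankel_op_one_ge:
  fixes z :: complex
  assumes fin: "finite_measure \<mu>" and unit: "borel_measure_unit \<mu>"
    and r: "0 < r" "r \<le> 1 / 2" and z: "norm (z - of_real (1 - r)) \<le> r / 4"
  shows "measure \<mu> {1 - r..1 - r / 2} / (40 * r\<^sup>2) \<le> norm (deriv (hankel_op \<mu> (\<lambda>_. 1)) z)"
proof -
  have "norm z \<le> norm (complex_of_real (1 - r)) + norm (z - of_real (1 - r))"
    by (metis diff_add_cancel norm_triangle_ineq add.commute)
  then have z1: "norm z < 1" using z r unfolding norm_of_real by linarith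
  note int = integrable_cauchy_square_kernel[OF fin unit z1]
  have I: "{1 - r..1 - r / 2} \<in> sets \<mu>"
    using r by (intro sets_unit[OF unit]) auto
  have "measure \<mu> {1 - r..1 - r / 2} / (40 * r\<^sup>2)
      = (\<integral>t. indicator {1 - r..1 - r / 2} t / (40 * r\<^sup>2) \<partial>\<mu>)"
    using I sets.sets_into_space[OF I] by (simp add: Int_absorb2)
  also have "\<dots> \<le> (\<integral>t. Re (of_real t / (1 - of_real t * z)\<^sup>2) \<partial>\<mu>)"
  proof (rule integral_mono)
    show "integrable \<mu> (\<lambda>t. indicator {1 - r..1 - r / 2} t / (40 * r\<^sup>2) :: real)"
      using I finite_measure.emeasure_finite[OF fin]
      by (intro integrable_divide_zero integrable_real_indicator) (auto simp: top.not_eq_extremum)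
  qed (use int Re_cauchy_square_kernel_ge[OF r z] space_borel_measure_unit[OF unit] in auto)
  also have "\<dots> = Re (deriv (hankel_op \<mu> (\<lambda>_. 1)) z)"
    by (simp only: deriv_hankel_op_one[OF fin unit z1] integral_Re[OF int])
  also have "\<dots> \<le> norm (deriv (hankel_op \<mu> (\<lambda>_. 1)) z)" by (rule complex_Re_le_cmod)
  finally show ?thesis .
qed

section \<open>A divergence test for the Besov integral\<close>

text \<open>
  The exponent starts at \<open>1\<close> so that the radius scale is at most \<open>1/2\<close>, as the lower bound for the
  derivative requires. The factor \<open>1/4\<close> keeps the disks disjoint: on the disk of scale \<open>r\<close> the
  distance \<open>1 - Re z\<close> lies between \<open>3r/4\<close> and \<open>5r/4\<close>, and \<open>5/4 \<cdot> r/2 < 3r/4\<close>.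
\<close>
definition dyadic_disk :: "nat \<Rightarrow> complex set" where
  "dyadic_disk k = ball (of_real (1 - (1 / 2) ^ Suc k)) ((1 / 2) ^ Suc k / 4)"

lemma dyadic_disk_bounds:
  assumes "z \<in> dyadic_disk k"
  defines "r \<equiv> (1 / 2) ^ Suc k"
  shows "norm (z - of_real (1 - r)) \<le> r / 4"
    and "3 / 4 * r \<le> 1 - norm z" and "1 - Re z \<le> 5 / 4 * r" and "norm z < 1"
proof -
  have r: "0 < r" "r \<le> 1 / 2" by (auto simp: r_def power_le_one)
  show z: "norm (z - of_real (1 - r)) \<le> r / 4"
    using assms(1) by (simp add: dyadic_disk_def r_def dist_norm norm_minus_commute)
  have "norm z \<le> norm (complex_of_real (1 - r)) + norm (z - of_real (1 - r))"
    by (metis diff_add_cancel norm_triangle_ineq add.commute)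
  then show "3 / 4 * r \<le> 1 - norm z" using z r unfolding norm_of_real by linarith
  then show "norm z < 1" using r by linarith
  show "1 - Re z \<le> 5 / 4 * r"
    using z abs_Re_le_cmod[of "z - of_real (1 - r)"] by simp
qed

lemma disjoint_family_dyadic_disk: "disjoint_family dyadic_disk"
proof -
  have "dyadic_disk m \<inter> dyadic_disk n = {}" if "m < n" for m n
  proof (rule ccontr)
    assume "\<not> ?thesis"
    then obtain z where z: "z \<in> dyadic_disk m" "z \<in> dyadic_disk n" by blast
    have "(1 / 2) ^ Suc n \<le> (1 / 2 :: real) ^ Suc (Suc m)"
      using that by (intro power_decreasing) auto
    moreover have "(0::real) < (1 / 2) ^ Suc m" by simp
    ultimately show False
      using dyadic_disk_bounds(2)[OF z(1)] dyadic_disk_bounds(3)[OF z(2)] complex_Re_le_cmod[of z]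
      unfolding power_Suc by linarith
  qed
  then show ?thesis
    unfolding disjoint_family_on_def by (metis Int_commute linorder_neqE_nat)
qed

lemma emeasure_dyadic_disk:
  "emeasure normalized_area (dyadic_disk k) = ennreal (((1 / 2) ^ Suc k)\<^sup>2 / 16)"
proof -
  have "emeasure normalized_area (dyadic_disk k)
      = ennreal (1 / pi) * emeasure lborel (dyadic_disk k)"
    unfolding normalized_area_def by (subst emeasure_density_const) (auto simp: dyadic_disk_def)
  also have "\<dots> = ennreal (1 / pi * (pi * ((1 / 2) ^ Suc k / 4)\<^sup>2))"
    unfolding dyadic_disk_def by (subst emeasure_ball) (auto simp: unit_ball_vol_2 ennreal_mult[symmetric])
  also have "1 / pi * (pi * ((1 / 2) ^ Suc k / 4)\<^sup>2) = ((1 / 2 :: real) ^ Suc k)\<^sup>2 / 16"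
    by (simp add: power_divide)
  finally show ?thesis .
qed

text \<open>
  If \<open>\<bar>f'\<bar>\<close> is at least \<open>h\<^sub>k / r\<close> on the disk of scale \<open>r\<close>, then this disk contributes at least
  a constant times \<open>r\<^sup>p\<^sup>-\<^sup>2 (h\<^sub>k / r)\<^sup>p r\<^sup>2 = h\<^sub>k\<^sup>p\<close> to the Besov integral. Summing over the
  disjoint disks shows that membership in the Besov space forces \<open>\<Sum> h\<^sub>k\<^sup>p < \<infinity>\<close>.
\<close>
lemma not_in_besov_space_if_derivative_large:
  assumes "0 \<le> p"
    and h: "\<And>k. 0 \<le> h k"
    and large: "\<And>k z. z \<in> dyadic_disk k \<Longrightarrow> h k / (1 / 2) ^ Suc k \<le> norm (deriv f z)"
    and div: "\<not> summable (\<lambda>k. h k powr p)"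
  shows "f \<notin> besov_space p"
proof -
  \<comment> \<open>On the disk of scale \<open>r\<close> one has \<open>3r/4 \<le> 1 - \<bar>z\<bar>\<^sup>2 \<le> 5r/2\<close>; which end gives the smaller
     weight depends on the sign of \<open>p - 2\<close>.\<close>
  define c where "c = min ((3 / 4) powr (p - 2)) ((5 / 2 :: real) powr (p - 2))"
  have c: "0 < c" by (simp add: c_def)
  let ?F = "\<lambda>z. (1 - (norm z)\<^sup>2) powr (p - 2) * norm (deriv f z) powr p"
  let ?r = "\<lambda>k. (1 / 2 :: real) ^ Suc k"
  let ?a = "\<lambda>k. c * h k powr p / (?r k)\<^sup>2"
  have lower: "?a k \<le> ?F z" if z: "z \<in> dyadic_disk k" for k z
  proof -
    define r where "r = ?r k"
    have r: "0 < r" by (simp add: r_def)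
    note b = dyadic_disk_bounds[OF z, folded r_def]
    have eq: "1 - (norm z)\<^sup>2 = (1 - norm z) * (1 + norm z)"
      by (simp add: power2_eq_square algebra_simps)
    have "(1 - norm z) * 1 \<le> 1 - (norm z)\<^sup>2"
      unfolding eq using b(4) by (intro mult_left_mono) auto
    then have w1: "3 / 4 * r \<le> 1 - (norm z)\<^sup>2"
      using b(2) unfolding mult_1_right by (rule order_trans[rotated])
    have "1 - (norm z)\<^sup>2 \<le> (1 - norm z) * 2"
      unfolding eq using b(4) by (intro mult_left_mono) auto
    also have "\<dots> \<le> 5 / 4 * r * 2"
      using b(3) complex_Re_le_cmod[of z] by (intro mult_right_mono) auto
    finally have w2: "1 - (norm z)\<^sup>2 \<le> 5 / 2 * r" by simp
    note w = w1 w2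
    have "c * r powr (p - 2) \<le> (1 - (norm z)\<^sup>2) powr (p - 2)"
    proof (cases "2 \<le> p")
      case True
      have "c * r powr (p - 2) \<le> (3 / 4) powr (p - 2) * r powr (p - 2)"
        by (intro mult_right_mono) (auto simp: c_def)
      also have "\<dots> = (3 / 4 * r) powr (p - 2)" by (rule powr_mult[symmetric])
      also have "\<dots> \<le> (1 - (norm z)\<^sup>2) powr (p - 2)"
        using w r True by (intro powr_mono2) auto
      finally show ?thesis .
    next
      case False
      have "c * r powr (p - 2) \<le> (5 / 2) powr (p - 2) * r powr (p - 2)"
        by (intro mult_right_mono) (auto simp: c_def)
      also have "\<dots> = (5 / 2 * r) powr (p - 2)" by (rule powr_mult[symmetric])
      also have "\<dots> \<le> (1 - (norm z)\<^sup>2) powr (p - 2)"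
        using w r False by (intro powr_mono2') auto
      finally show ?thesis .
    qed
    moreover have "(h k / r) powr p \<le> norm (deriv f z) powr p"
      using large[OF z] h[of k] r assms(1) by (intro powr_mono2) (auto simp: r_def)
    ultimately have "c * r powr (p - 2) * (h k / r) powr p \<le> ?F z"
      using c by (intro mult_mono) auto
    moreover have "c * r powr (p - 2) * (h k / r) powr p = c * h k powr p / r\<^sup>2"
      using r h[of k] by (simp add: powr_divide powr_diff powr_numeral)
    ultimately show ?thesis by (simp add: r_def)
  qed
  have [measurable]: "dyadic_disk k \<in> sets normalized_area" for k
    by (simp add: normalized_area_def dyadic_disk_def)
  have "\<not> summable (\<lambda>k. c / 16 * h k powr p)"
    using div c by (subst summable_cmult_iff) auto
  moreover have "0 \<le> c / 16 * h k powr p" for k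
    using c by simp
  ultimately have "(\<Sum>k. ennreal (c / 16 * h k powr p)) = top"
    using summable_suminf_not_top[of "\<lambda>k. c / 16 * h k powr p"] by metis
  then have "top = (\<Sum>k. ennreal (c / 16 * h k powr p))" by (rule sym)
  also have "\<dots> = (\<Sum>k. ennreal (?a k) * emeasure normalized_area (dyadic_disk k))"
    unfolding emeasure_dyadic_disk using c
    by (intro suminf_cong) (auto simp: ennreal_mult[symmetric] simp del: power_Suc)
  also have "\<dots> = (\<integral>\<^sup>+z. (\<Sum>k. ennreal (?a k) * indicator (dyadic_disk k) z) \<partial>normalized_area)"
    by (subst nn_integral_suminf) (auto simp: nn_integral_cmult_indicator)
  also have "\<dots> \<le> (\<integral>\<^sup>+z\<in>ball 0 1. ennreal (?F z) \<partial>normalized_area)"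
  proof (rule nn_integral_mono)
    fix z :: complex
    show "(\<Sum>k. ennreal (?a k) * indicator (dyadic_disk k) z)
        \<le> ennreal (?F z) * indicator (ball 0 1) z"
    proof (cases "\<exists>k. z \<in> dyadic_disk k")
      case True
      then obtain k where k: "z \<in> dyadic_disk k" by blast
      have "(\<Sum>k. ennreal (?a k) * indicator (dyadic_disk k) z) = ennreal (?a k)"
        by (rule suminf_cmult_indicator[OF disjoint_family_dyadic_disk k])
      also have "\<dots> \<le> ennreal (?F z)" using lower[OF k] by (rule ennreal_leI)
      finally show ?thesis using dyadic_disk_bounds(4)[OF k] by simp
    next
      case False
      then show ?thesis by simp
    qed
  qed
  finally have "besov_seminorm p f = \<infinity>"
    by (simp add: besov_seminorm_def ennpowr_def top.extremum_unique)
  then show ?thesis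
    by (simp add: besov_space_def besov_norm_def ennpowr_def)
qed

text \<open>
  The divergence test applied to the lower bound for the derivative of the image of \<open>1\<close>. With \<open>r = 2\<^sup>-\<^sup>k\<^sup>-\<^sup>1\<close> the derivative bound
  \<open>\<mu>([1 - r, 1 - r/2]) / (40 r\<^sup>2)\<close> is \<open>1 / r\<close> times \<open>\<mu>([1 - r, 1 - r/2]) 2\<^sup>k / 20\<close>, because
  \<open>1 / r = 2 \<cdot> 2\<^sup>k\<close>.
\<close>
lemma hankel_op_one_not_in_besov_space:
  assumes "finite_measure \<mu>" "borel_measure_unit \<mu>" "0 \<le> p"
    and "\<not> summable (\<lambda>k. (measure \<mu> {1 - (1 / 2) ^ Suc k..1 - (1 / 2) ^ Suc (Suc k)} * 2 ^ k) powr p)"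
      (is "\<not> summable (\<lambda>k. ?m k powr p)")
  shows "hankel_op \<mu> (\<lambda>_. 1) \<notin> besov_space p"
proof (rule not_in_besov_space_if_derivative_large)
  show "0 \<le> p" by fact
  show "0 \<le> ?m k / 20" for k by simp
  have "(\<lambda>k. (?m k / 20) powr p) = (\<lambda>k. (1 / 20 powr p) * ?m k powr p)"
    by (auto simp: powr_divide)
  then show "\<not> summable (\<lambda>k. (?m k / 20) powr p)"
    using assms(4) by (simp only: summable_cmult_iff) simp
next
  fix k and z assume z: "z \<in> dyadic_disk k"
  define r where "r = (1 / 2 :: real) ^ Suc k"
  have r: "0 < r" "r \<le> 1 / 2" by (auto simp: r_def power_le_one)
  have "measure \<mu> {1 - r..1 - r / 2} / (40 * r\<^sup>2) \<le> norm (deriv (hankel_op \<mu> (\<lambda>_. 1)) z)"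
    using dyadic_disk_bounds(1)[OF z] r unfolding r_def
    by (intro norm_deriv_hankel_op_one_ge assms)
  moreover have "2 ^ k = 1 / (2 * r)" by (simp add: r_def power_divide)
  ultimately show "?m k / 20 / (1 / 2) ^ Suc k \<le> norm (deriv (hankel_op \<mu> (\<lambda>_. 1)) z)"
    using r by (simp add: r_def[symmetric] power2_eq_square) (simp add: r_def)
qed

section \<open>The measure with logarithmic density\<close>

definition log_weight :: "real \<Rightarrow> real \<Rightarrow> real" where
  "log_weight \<beta> t = ln (2 / (1 - t)) powr (- \<beta>)"

definition log_measure :: "real \<Rightarrow> real measure" where
  "log_measure \<beta> = density (restrict_space lborel {0..<1}) (\<lambda>t. ennreal (log_weight \<beta> t))"

lemma borel_measure_unit_log_measure: "borel_measure_unit (log_measure \<beta>)"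
  by (simp add: borel_measure_unit_def log_measure_def cong: sets_restrict_space_cong)

lemma log_weight_antimono:
  assumes "0 \<le> \<beta>" "0 \<le> s" "s \<le> t" "t < 1"
  shows "log_weight \<beta> t \<le> log_weight \<beta> s"
  unfolding log_weight_def
proof (rule powr_mono2')
  have "2 / (1 - s) \<le> 2 / (1 - t)" and one: "1 < 2 / (1 - s)"
    using assms by (auto simp: field_simps)
  then show "ln (2 / (1 - s)) \<le> ln (2 / (1 - t))"
    using assms by (intro ln_mono) auto
  show "0 < ln (2 / (1 - s))" using one by (rule ln_gt_zero)
qed (use assms in auto)

lemma emeasure_log_measure:
  assumes "A \<in> sets borel" "A \<subseteq> {0..<1}"
  shows "emeasure (log_measure \<beta>) A = (\<integral>\<^sup>+t\<in>A. ennreal (log_weight \<beta> t) \<partial>lborel)"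
proof -
  have [measurable]: "(\<lambda>t. ennreal (log_weight \<beta> t)) \<in> borel_measurable borel"
    unfolding log_weight_def by measurable
  have "emeasure (log_measure \<beta>) A
      = (\<integral>\<^sup>+t. ennreal (log_weight \<beta> t) * indicator A t \<partial>restrict_space lborel {0..<1})"
    unfolding log_measure_def using assms
    by (intro emeasure_density) (auto simp: sets_restrict_space_iff intro!: measurable_restrict_space1)
  also have "\<dots> = (\<integral>\<^sup>+t. ennreal (log_weight \<beta> t) * indicator A t * indicator {0..<1} t \<partial>lborel)"
    by (rule nn_integral_restrict_space) simp
  also have "\<dots> = (\<integral>\<^sup>+t\<in>A. ennreal (log_weight \<beta> t) \<partial>lborel)"
    using assms by (intro nn_integral_cong) (auto simp: indicator_def)
  finally show ?thesis .
qed

text \<open>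
  The density decreases, so it may be replaced on \<open>[t,1)\<close> by its value at \<open>t\<close>, which is the
  reciprocal of the logarithmic factor in the Carleson condition.
\<close>
lemma log_carleson_log_measure:
  assumes "0 \<le> \<beta>"
  shows "log_carleson \<beta> 1 (log_measure \<beta>)"
  unfolding log_carleson_def
proof (intro conjI exI[of _ 1] ballI)
  fix t :: real assume t: "t \<in> {0..<1}"
  have "emeasure (log_measure \<beta>) {t..<1} = (\<integral>\<^sup>+s\<in>{t..<1}. ennreal (log_weight \<beta> s) \<partial>lborel)"
    using t by (intro emeasure_log_measure) auto
  also have "\<dots> \<le> (\<integral>\<^sup>+s. ennreal (log_weight \<beta> t) * indicator {t..<1} s \<partial>lborel)"
    using t log_weight_antimono[OF assms]
    by (intro nn_integral_mono) (auto simp: indicator_def intro!: ennreal_leI)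
  also have "\<dots> = ennreal (log_weight \<beta> t * (1 - t))"
    using t by (simp add: nn_integral_cmult_indicator ennreal_mult log_weight_def)
  finally have "emeasure (log_measure \<beta>) {t..<1} * ennreal (ln (2 / (1 - t)) powr \<beta>)
      \<le> ennreal (log_weight \<beta> t * (1 - t)) * ennreal (ln (2 / (1 - t)) powr \<beta>)"
    by (rule mult_right_mono) simp
  also have "\<dots> = ennreal (log_weight \<beta> t * ln (2 / (1 - t)) powr \<beta> * (1 - t))"
    using t by (simp add: ennreal_mult[symmetric] log_weight_def mult_ac)
  also have "log_weight \<beta> t * ln (2 / (1 - t)) powr \<beta> = 1"
  proof -
    have "1 < 2 / (1 - t)" using t by (auto simp: field_simps)
    then have "0 < ln (2 / (1 - t))" by (rule ln_gt_zero)
    then show ?thesis unfolding log_weight_def powr_minus by simp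
  qed
  finally show "emeasure (log_measure \<beta>) {t..<1} * ennreal (ln (2 / (1 - t)) powr \<beta>)
      \<le> ennreal (1 * (1 - t) powr 1)"
    using t by simp
qed (simp_all add: borel_measure_unit_log_measure)

text \<open>
  On the interval, of length \<open>r / 2\<close> with \<open>r = 2\<^sup>-\<^sup>k\<^sup>-\<^sup>1\<close>, the decreasing density is smallest at the
  right endpoint \<open>1 - r/2\<close>, where the logarithm is \<open>log (4 / r) = (k + 3) log 2 \<le> k + 3\<close>.
\<close>
lemma measure_log_measure_dyadic_ge:
  assumes "0 \<le> \<beta>"
  shows "real (k + 3) powr (- \<beta>) / 4
       \<le> measure (log_measure \<beta>) {1 - (1 / 2) ^ Suc k..1 - (1 / 2) ^ Suc (Suc k)} * 2 ^ k"
proof -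
  define r where "r = (1 / 2 :: real) ^ Suc k"
  have r: "0 < r" "r \<le> 1 / 2" by (auto simp: r_def power_le_one)
  let ?I = "{1 - r..1 - r / 2}"
  have "ln (2 / (1 - (1 - r / 2))) = ln (2 ^ (k + 3))"
    by (simp add: r_def power_divide power_add)
  also have "\<dots> \<le> real (k + 3)"
    using ln_le_minus_one[of "2 :: real"] by (subst ln_realpow) (auto intro!: mult_left_le)
  finally have "real (k + 3) powr (- \<beta>) \<le> log_weight \<beta> (1 - r / 2)"
    unfolding log_weight_def using r assms by (intro powr_mono2') auto
  then have "ennreal (real (k + 3) powr (- \<beta>) * (r / 2))
      \<le> ennreal (log_weight \<beta> (1 - r / 2) * (r / 2))"
    using r by (intro ennreal_leI mult_right_mono) auto
  also have "\<dots> = (\<integral>\<^sup>+t. ennreal (log_weight \<beta> (1 - r / 2)) * indicator ?I t \<partial>lborel)"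
    using r by (subst nn_integral_cmult_indicator)
      (auto simp: ennreal_mult[symmetric] log_weight_def)
  also have "\<dots> \<le> (\<integral>\<^sup>+t\<in>?I. ennreal (log_weight \<beta> t) \<partial>lborel)"
    using r log_weight_antimono[OF assms]
    by (intro nn_integral_mono) (auto simp: indicator_def intro!: ennreal_leI)
  also have "\<dots> = emeasure (log_measure \<beta>) ?I"
    using r by (intro emeasure_log_measure[symmetric]) auto
  also have "\<dots> = ennreal (measure (log_measure \<beta>) ?I)"
    using log_carleson_finite_measure[OF log_carleson_log_measure[OF assms]]
    by (rule finite_measure.emeasure_eq_measure)
  finally have "real (k + 3) powr (- \<beta>) * (r / 2) \<le> measure (log_measure \<beta>) ?I"
    by (simp add: ennreal_le_iff)
  then have "real (k + 3) powr (- \<beta>) * (r / 2) * 2 ^ k \<le> measure (log_measure \<beta>) ?I * 2 ^ k"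
    by (rule mult_right_mono) simp
  also have "real (k + 3) powr (- \<beta>) * (r / 2) * 2 ^ k = real (k + 3) powr (- \<beta>) / 4"
    by (simp add: r_def power_divide)
  finally show ?thesis by (simp add: r_def)
qed

section \<open>The Hankel operator does not preserve the Besov space\<close>

theorem theorem3p6:
  fixes p \<beta> :: real
  assumes "1 < p" and "0 < \<beta>" and "\<beta> \<le> 1 / p"
  shows "\<exists>\<mu>. log_carleson \<beta> 1 \<mu> \<and>
           \<not> hankel_op \<mu> ` (besov_space p \<inter> hankel_domain \<mu>) \<subseteq> besov_space p"
proof (intro exI conjI)
  let ?\<mu> = "log_measure \<beta>"
  show carleson: "log_carleson \<beta> 1 ?\<mu>"
    using assms(2) by (intro log_carleson_log_measure) auto
  note fin = log_carleson_finite_measure[OF carleson]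
  note unit = borel_measure_unit_log_measure[of \<beta>]
  let ?m = "\<lambda>k. measure ?\<mu> {1 - (1 / 2) ^ Suc k..1 - (1 / 2) ^ Suc (Suc k)} * 2 ^ k"
  have "\<not> summable (\<lambda>k. ?m k powr p)"
  proof
    assume "summable (\<lambda>k. ?m k powr p)"
    then have "summable (\<lambda>k. 4 powr p * ?m k powr p)" by (rule summable_mult)
    then have "summable (\<lambda>k. inverse (real (k + 3)))"
    proof (rule summable_comparison_test'[where N = 0])
      fix k :: nat
      have "inverse (real (k + 3)) = real (k + 3) powr (- 1)"
        by (subst powr_minus) simp
      \<comment> \<open>The hypothesis \<open>\<beta> \<le> 1 / p\<close> enters here, as \<open>\<beta> p \<le> 1\<close>.\<close>
      also have "\<dots> \<le> real (k + 3) powr (- \<beta> * p)"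
        using assms by (intro powr_mono) (auto simp: field_simps)
      also have "\<dots> = (real (k + 3) powr (- \<beta>)) powr p" by (simp add: powr_powr)
      also have "\<dots> \<le> (4 * ?m k) powr p"
      proof (rule powr_mono2)
        show "real (k + 3) powr (- \<beta>) \<le> 4 * ?m k"
          using measure_log_measure_dyadic_ge[of \<beta> k] assms(2) by linarith
      qed (use assms(1) in auto)
      also have "\<dots> = 4 powr p * ?m k powr p" by (rule powr_mult)
      finally show "norm (inverse (real (k + 3))) \<le> 4 powr p * ?m k powr p" by simp
    qed
    then have "summable (\<lambda>k. inverse (of_nat k) :: real)"
      by (rule summable_iff_shift[THEN iffD1])
    then show False using not_summable_harmonic[where 'a = real] by contradiction
  qed
  then have "hankel_op ?\<mu> (\<lambda>_. 1) \<notin> besov_space p"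
    using assms(1) by (intro hankel_op_one_not_in_besov_space[OF fin unit]) simp_all
  moreover have "hankel_op ?\<mu> (\<lambda>_. 1) \<in> hankel_op ?\<mu> ` (besov_space p \<inter> hankel_domain ?\<mu>)"
    by (intro imageI IntI one_in_besov_space one_in_hankel_domain[OF fin unit])
  ultimately show "\<not> hankel_op ?\<mu> ` (besov_space p \<inter> hankel_domain ?\<mu>) \<subseteq> besov_space p"
    using subsetD by metis
qed

end
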